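(* Let $A^1,A^2$ be adjacency matrices in $\{0,1\}^{n\times n}$, $\Pi$ a group of permutations of $\{1,\dots,n\}$, $A^0\in\{0,1\}^{n\times n}$, $\mathcal A=\{A^0_\pi:\pi\in\Pi\}$, and $\mathcal E$ a nonempty set of pairs. Denote $Y_{ij}=y_{ij}(A^2)$, $D_{ij}=d_{ij}(A^1)\in\mathbb R$. Assume throughout: (1) $A^2=f(A^1)$; (2) both $A^1,A^2$ are observed; (3) $P(A^1=A\mid f)=1/|\mathcal A|$ for all $A\in\mathcal A$; (4) for every $(i,j)\in\mathcal E$ and every value $d$ attained by $d_{ij}$ on $\mathcal A$ there is a real number $Y_{ij}^d$ (depending only on $f$) such that for all $A\in\mathcal A$, $d_{ij}(A)=d$ implies $y_{ij}(f(A))=Y_{ij}^d$; (5) $(i,j)\in\mathcal E\Rightarrow(\pi(i),\pi(j))\in\mathcal E$, and $d_{ij}(A_\pi)=d_{\pi(i),\pi(j)}(A)$, for all $\pi\in\Pi$, $(i,j)\in\mathcal E$, $A\in\mathcal A$. Suppose the sharp null hypothesis holds: $Y_{ij}^d$ does not depend on $d$, for all $(i,j)\in\mathcal E$. Let $\alpha\in(0,1)$. (a) Suppose there is a finite set $\mathcal D\subseteq\mathbb R$ such that $D_{ij}$ takes values in $\mathcal D$ and $P(D_{ij}=d)>0$ for every $(i,j)\in\mathcal E$ and $d\in\mathcal D$, with $\sum_{d\in\mathcal D}d^2>0$. Let $p_{ij}(d)=P(D_{ij}=d)$, $P_{ij}=p_{ij}(D_{ij})$, and $$\widehat\beta=\operatorname*{argmin}_b\sum_{(i,j)\in\mathcal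 E}\frac1{P_{ij}}\left(Y_{ij}-D_{ij}\cdot b\right)^2.$$ For $\pi\in\Pi$ define $$\widehat\beta_\pi=\operatorname*{argmin}_b\sum_{(i,j)\in\mathcal E}\frac1{P_{\pi(i)\pi(j)}}\left(Y_{ij}-D_{\pi(i)\pi(j)}\cdot b\right)^2,\qquad p^\beta=\frac1{|\Pi|}\sum_{\pi\in\Pi}\mathbf 1\left(\widehat\beta\le\widehat\beta_\pi\right).$$ Then $P(p^\beta\le\alpha\mid f)\le\alpha$. (b) Suppose $\mathcal E=\mathcal I\times\mathcal J$ with $\mathcal I,\mathcal J\subseteq\{1,\dots,n\}$, $\mathcal I\cap\mathcal J=\emptyset$, $\Pi=\{\pi\in\mathcal S_n:\pi(j)=j\ \forall j\notin\mathcal I\}$, and $\sum_{i\in\mathcal I}D_{ij}^2>0$ for all $j\in\mathcal J$. Let $$\widehat\gamma=\frac1{|\mathcal J|}\sum_{j\in\mathcal J}\operatorname*{argmin}_c\sum_{i\in\mathcal I}\left(Y_{ij}-D_{ij}\cdot c\right)^2,$$ and for $\pi\in\Pi$ $$\widehat\gamma_\pi=\frac1{|\mathcal J|}\sum_{j\in\mathcal J}\operatorname*{argmin}_c\sum_{i\in\mathcal I}\left(Y_{ij}-D_{\pi(i)j}\cdot c\right)^2,\qquad p^\gamma=\frac1{|\Pi|}\sum_{\pi\in\Pi}\mathbf 1\left(\widehat\gamma\le\widehat\gamma_\pi\right).$$ Then $P(p^\gamma\le\alpha\mid f)\le\alpha$.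
   Context: $\mathcal S_n$ is the group of all permutations of $\{1,\dots,n\}$. For a matrix $A$ and a permutation $\pi$, $A_\pi$ denotes the matrix with $(i,j)$ entry $A_{\pi(i),\pi(j)}$. The map $f$ on adjacency matrices may be random; $\mathcal A$, $\mathcal E$, $d_{ij}$, $y_{ij}$ are non-random, and $d_{ij}$, $y_{ij}$ are real-valued (the scalar case). The notation $P_{\pi(i)\pi(j)}$ means $p_{\pi(i)\pi(j)}(D_{\pi(i)\pi(j)})$. *)

theory Defs
  imports "HOL-Probability.Probability" "HOL-Algebra.Sym_Groups"
begin

text \<open>The 0-1 matrices of size n by n, as extensional functions on \<open>{1..n} \<times> {1..n}\<close>, so that
  equality is entrywise and the set is finite. No symmetry or zero diagonal is required.\<close>

definition adj_matrices :: "nat \<Rightarrow> (nat \<times> nat \<Rightarrow> nat) set" where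
  "adj_matrices n = {1..n} \<times> {1..n} \<rightarrow>\<^sub>E {0, 1}"

definition perm_matrix :: "nat \<Rightarrow> (nat \<times> nat \<Rightarrow> nat) \<Rightarrow> (nat \<Rightarrow> nat) \<Rightarrow> nat \<times> nat \<Rightarrow> nat" where
  "perm_matrix n A \<pi> = (\<lambda>(i, j) \<in> {1..n} \<times> {1..n}. A (\<pi> i, \<pi> j))"

definition adj_maps :: "nat \<Rightarrow> ((nat \<times> nat \<Rightarrow> nat) \<Rightarrow> nat \<times> nat \<Rightarrow> nat) set" where
  "adj_maps n = adj_matrices n \<rightarrow>\<^sub>E adj_matrices n"

text \<open>Conditional probability of an event given a random element \<open>X\<close> with values in \<open>N\<close>: the
  conditional expectation of its indicator with respect to the sigma-algebra generated by \<open>X\<close>.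
  It is determined almost surely, so statements about it are read almost everywhere.\<close>

definition prob_given ::
  "'w measure \<Rightarrow> 'c measure \<Rightarrow> ('w \<Rightarrow> 'c) \<Rightarrow> ('w \<Rightarrow> bool) \<Rightarrow> 'w \<Rightarrow> real" where
  "prob_given M N X Q =
     real_cond_exp M (vimage_algebra (space M) X N) (indicator {\<omega> \<in> space M. Q \<omega>})"

text \<open>Below, \<open>Y\<close> and \<open>D\<close> are realized arrays and \<open>p i j \<delta>\<close> is the probability that the \<open>(i,j)\<close>
  entry of \<open>D\<close> equals \<open>\<delta>\<close>. The minimizations are over all reals; when the minimizer is
  not unique, \<open>arg_min\<close> returns an unspecified one.\<close>

definition beta_hat ::
  "(nat \<times> nat) set \<Rightarrow> (nat \<Rightarrow> nat \<Rightarrow> real \<Rightarrow> real) \<Rightarrow> (nat \<Rightarrow> nat \<Rightarrow> real) \<Rightarrow> (nat \<Rightarrow> nat \<Rightarrow> real) \<Rightarrow> real" where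
  "beta_hat E p Y D =
     arg_min (\<lambda>b. \<Sum>(i, j)\<in>E. 1 / p i j (D i j) * (Y i j - D i j * b)\<^sup>2) (\<lambda>_. True)"

definition beta_hat_perm ::
  "(nat \<times> nat) set \<Rightarrow> (nat \<Rightarrow> nat \<Rightarrow> real \<Rightarrow> real) \<Rightarrow> (nat \<Rightarrow> nat \<Rightarrow> real) \<Rightarrow> (nat \<Rightarrow> nat \<Rightarrow> real) \<Rightarrow>
     (nat \<Rightarrow> nat) \<Rightarrow> real" where
  "beta_hat_perm E p Y D \<pi> =
     arg_min (\<lambda>b. \<Sum>(i, j)\<in>E. 1 / p (\<pi> i) (\<pi> j) (D (\<pi> i) (\<pi> j)) * (Y i j - D (\<pi> i) (\<pi> j) * b)\<^sup>2)
       (\<lambda>_. True)"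

definition gamma_hat ::
  "nat set \<Rightarrow> nat set \<Rightarrow> (nat \<Rightarrow> nat \<Rightarrow> real) \<Rightarrow> (nat \<Rightarrow> nat \<Rightarrow> real) \<Rightarrow> real" where
  "gamma_hat I J Y D =
     1 / real (card J) * (\<Sum>j\<in>J. arg_min (\<lambda>c. \<Sum>i\<in>I. (Y i j - D i j * c)\<^sup>2) (\<lambda>_. True))"

definition gamma_hat_perm ::
  "nat set \<Rightarrow> nat set \<Rightarrow> (nat \<Rightarrow> nat \<Rightarrow> real) \<Rightarrow> (nat \<Rightarrow> nat \<Rightarrow> real) \<Rightarrow> (nat \<Rightarrow> nat) \<Rightarrow> real" where
  "gamma_hat_perm I J Y D \<pi> =
     1 / real (card J) * (\<Sum>j\<in>J. arg_min (\<lambda>c. \<Sum>i\<in>I. (Y i j - D (\<pi> i) j * c)\<^sup>2) (\<lambda>_. True))"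

definition p_value :: "(nat \<Rightarrow> nat) set \<Rightarrow> real \<Rightarrow> ((nat \<Rightarrow> nat) \<Rightarrow> real) \<Rightarrow> real" where
  "p_value G t t_perm = 1 / real (card G) * (\<Sum>\<pi>\<in>G. of_bool (t \<le> t_perm \<pi>))"

definition p_beta ::
  "(nat \<Rightarrow> nat) set \<Rightarrow> (nat \<times> nat) set \<Rightarrow> (nat \<Rightarrow> nat \<Rightarrow> real \<Rightarrow> real) \<Rightarrow>
     (nat \<Rightarrow> nat \<Rightarrow> real) \<Rightarrow> (nat \<Rightarrow> nat \<Rightarrow> real) \<Rightarrow> real" where
  "p_beta G E p Y D = p_value G (beta_hat E p Y D) (beta_hat_perm E p Y D)"

definition p_gamma ::
  "(nat \<Rightarrow> nat) set \<Rightarrow> nat set \<Rightarrow> nat set \<Rightarrow> (nat \<Rightarrow> nat \<Rightarrow> real) \<Rightarrow> (nat \<Rightarrow> nat \<Rightarrow> real) \<Rightarrow> real" where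
  "p_gamma G I J Y D = p_value G (gamma_hat I J Y D) (gamma_hat_perm I J Y D)"

end

theory Submission
  imports Defs
begin

text \<open>Under the sharp null, \<open>Y\<close> is on \<open>\<E>\<close> a function of \<open>f\<close> alone, so given \<open>f\<close> the statistic is a
  function \<open>T\<close> of \<open>A\<^sup>1\<close>, and by equivariance its permuted version is \<open>T (A\<^sup>1\<^sub>\<pi>)\<close>; for \<open>\<beta>\<close> this also
  uses that the weights \<open>p\<^sub>i\<^sub>j\<close> are invariant under \<open>G\<close>, as \<open>A\<^sup>1\<close> is uniform on an orbit. Hence the
  p-value is the fraction of the orbit on which \<open>T\<close> is at least \<open>T (A\<^sup>1)\<close>, and for \<open>A\<^sup>1\<close> uniform on
  the orbit such a normalized rank is stochastically no smaller than a uniform variable.\<close>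

section \<open>Counting ranks in a finite set\<close>

text \<open>All elements of the counted set lie weakly above the one where \<open>T\<close> is
  least. As that element is itself counted, at most \<open>\<alpha> * card S\<close> elements lie
  weakly above it.\<close>

lemma card_rank_fraction_le:
  fixes T :: "'a \<Rightarrow> real" and \<alpha> :: real
  assumes "finite S" "0 \<le> \<alpha>"
  shows "card {a\<in>S. card {b\<in>S. T a \<le> T b} \<le> \<alpha> * card S} \<le> \<alpha> * card S"
proof (cases "{a\<in>S. card {b\<in>S. T a \<le> T b} \<le> \<alpha> * card S} = {}")
  case True
  show ?thesis unfolding True using assms by simp
next
  case False
  let ?R = "{a\<in>S. card {b\<in>S. T a \<le> T b} \<le> \<alpha> * card S}"
  have fin: "finite ?R" using assms by simp
  define a where "a = arg_min_on T ?R"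
  have a: "a \<in> ?R" and min: "\<And>b. b \<in> ?R \<Longrightarrow> T a \<le> T b"
    using arg_min_if_finite(1)[OF fin False] arg_min_least[OF fin False] unfolding a_def by blast+
  have "card ?R \<le> card {b\<in>S. T a \<le> T b}"
    using assms min by (intro card_mono) auto
  then show ?thesis using a by simp
qed

section \<open>Conditioning on \<open>f\<close> for a uniform random element\<close>

text \<open>Integrating the conditional probabilities makes them unconditional. The events
  \<open>X = a\<close> for \<open>a\<close> in \<open>S\<close> are disjoint and their probabilities
  add up to one, which leaves no mass outside \<open>S\<close>.\<close>

lemma AE_in_uniform_support:
  assumes M: "prob_space M"
    and X: "X \<in> M \<rightarrow>\<^sub>M count_space U"
    and f: "f \<in> M \<rightarrow>\<^sub>M N"
    and fin: "finite S" and ne: "S \<noteq> {}"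
    and unif: "\<forall>a\<in>S. AE \<omega> in M. prob_given M N f (\<lambda>\<omega>'. X \<omega>' = a) \<omega> = 1 / card S"
  shows "\<And>a. a \<in> S \<Longrightarrow> \<P>(\<omega> in M. X \<omega> = a) = 1 / card S"
    and "AE \<omega> in M. X \<omega> \<in> S"
proof -
  interpret prob_space M by fact
  define F where "F = vimage_algebra (space M) f N"
  have "subalgebra M F"
    unfolding F_def subalgebra_def using measurable_sets[OF f] measurable_space[OF f]
    by (auto simp: sets_vimage_algebra2)
  then interpret F: sigma_finite_subalgebra M F
    by (intro finite_measure_subalgebra_is_sigma_finite finite_measure_subalgebra.intro
        finite_measure_subalgebra_axioms.intro finite_measure_axioms)
  have meas: "{\<omega> \<in> space M. X \<omega> = a} \<in> sets M" for a
    using measurable_sets_Collect[OF X, of "\<lambda>x. x = a"] by (auto simp: subset_eq)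
  show prob: "\<P>(\<omega> in M. X \<omega> = a) = 1 / card S" if "a \<in> S" for a
  proof -
    let ?I = "indicator {\<omega> \<in> space M. X \<omega> = a} :: _ \<Rightarrow> real"
    have "integrable M ?I" using meas by (simp add: integrable_indicator_iff less_top[symmetric])
    have "\<P>(\<omega> in M. X \<omega> = a) = (\<integral>\<omega>. ?I \<omega> \<partial>M)" using meas by simp
    also have "\<dots> = (\<integral>\<omega>. real_cond_exp M F ?I \<omega> \<partial>M)"
      by (rule F.real_cond_exp_int(2)[symmetric]) fact
    also have "\<dots> = (\<integral>\<omega>. 1 / card S \<partial>M)"
      using unif that unfolding prob_given_def F_def by (intro integral_cong_AE) auto
    finally show ?thesis by (simp add: prob_space)
  qed
  have disj: "disjoint_family_on (\<lambda>a. {\<omega> \<in> space M. X \<omega> = a}) S"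
    by (auto simp: disjoint_family_on_def)
  have eq: "{\<omega> \<in> space M. X \<omega> \<in> S} = (\<Union>a\<in>S. {\<omega> \<in> space M. X \<omega> = a})" by auto
  have "\<P>(\<omega> in M. X \<omega> \<in> S) = (\<Sum>a\<in>S. \<P>(\<omega> in M. X \<omega> = a))"
    unfolding eq using fin meas disj by (intro finite_measure_finite_Union) auto
  also have "\<dots> = 1" using prob fin ne by simp
  finally show "AE \<omega> in M. X \<omega> \<in> S"
    using meas fin by (subst (asm) prob_Collect_eq_1) (auto simp: pred_def eq)
qed

text \<open>Given \<open>f\<close>, \<open>X\<close> is uniform on \<open>S\<close>, so an event
  decided by \<open>f\<close> and \<open>X\<close> is evaluated by freezing \<open>f\<close> and
  counting over \<open>S\<close>. To see this, split its indicator by the value of \<open>X\<close>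
  and pull the factor that depends on \<open>f\<close> out of the conditional expectation.\<close>

lemma prob_given_uniform:
  assumes M: "prob_space M"
    and X: "X \<in> M \<rightarrow>\<^sub>M count_space U"
    and f: "f \<in> M \<rightarrow>\<^sub>M count_space V"
    and fin: "finite S" and ne: "S \<noteq> {}"
    and unif: "\<forall>a\<in>S.
      AE \<omega> in M. prob_given M (count_space V) f (\<lambda>\<omega>'. X \<omega>' = a) \<omega> = 1 / card S"
    and Q: "{\<omega> \<in> space M. Q \<omega>} \<in> sets M"
    and QR: "AE \<omega> in M. Q \<omega> \<longleftrightarrow> R (f \<omega>) (X \<omega>)"
  shows "AE \<omega> in M. prob_given M (count_space V) f Q \<omega> = card {a\<in>S. R (f \<omega>) a} / card S"
proof -
  interpret prob_space M by fact
  define F where "F = vimage_algebra (space M) f (count_space V)"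
  have "subalgebra M F"
    unfolding F_def subalgebra_def using measurable_sets[OF f] measurable_space[OF f]
    by (auto simp: sets_vimage_algebra2)
  then interpret F: sigma_finite_subalgebra M F
    by (intro finite_measure_subalgebra_is_sigma_finite finite_measure_subalgebra.intro
        finite_measure_subalgebra_axioms.intro finite_measure_axioms)
  have fF: "f \<in> F \<rightarrow>\<^sub>M count_space V"
    unfolding F_def using measurable_space[OF f] by (intro measurable_vimage_algebra1) auto
  define I where "I a = (indicator {\<omega> \<in> space M. X \<omega> = a} :: _ \<Rightarrow> real)" for a
  define h where "h a \<omega> = (of_bool (R (f \<omega>) a) :: real)" for a \<omega>
  have "{\<omega> \<in> space M. X \<omega> = a} \<in> sets M" for a
    using measurable_sets_Collect[OF X, of "\<lambda>x. x = a"] by (auto simp: subset_eq)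
  then have I [measurable]: "I a \<in> borel_measurable M" for a
    unfolding I_def by simp
  \<comment> \<open>Every predicate is measurable on \<open>count_space V\<close>, so
    \<open>R\<close> may be arbitrary.\<close>
  have h: "h a \<in> borel_measurable F" for a
    unfolding h_def by (rule measurable_compose[OF fF]) simp
  have [measurable]: "h a \<in> borel_measurable M" for a
    by (rule measurable_from_subalg[OF F.subalg h])
  have int: "integrable M (\<lambda>\<omega>. h a \<omega> * I a \<omega>)" for a
    proof (rule integrable_const_bound[where B = 1])
    show "AE \<omega> in M. norm (h a \<omega> * I a \<omega>) \<le> 1"
      by (simp add: h_def I_def indicator_def)
  qed measurable
  \<comment> \<open>Where \<open>X\<close> lies in \<open>S\<close>, only the summand
    \<open>a = X \<omega>\<close> survives.\<close>
  have "AE \<omega> in M. indicator {\<omega> \<in> space M. Q \<omega>} \<omega> = (\<Sum>a\<in>S. h a \<omega> * I a \<omega>)"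
    using QR AE_in_uniform_support(2)[OF M X f fin ne unif] AE_space
  proof eventually_elim
    case (elim \<omega>)
    have "(\<Sum>a\<in>S. h a \<omega> * I a \<omega>) = (\<Sum>a\<in>S. if a = X \<omega> then h a \<omega> else 0)"
      using elim by (intro sum.cong) (auto simp: I_def)
    then show ?case using elim fin by (simp add: h_def)
  qed
  then have 1: "AE \<omega> in M. prob_given M (count_space V) f Q \<omega>
      = real_cond_exp M F (\<lambda>\<omega>. \<Sum>a\<in>S. h a \<omega> * I a \<omega>) \<omega>"
    unfolding prob_given_def F_def[symmetric] using Q
    by (intro F.real_cond_exp_cong) auto
  have 2: "AE \<omega> in M. real_cond_exp M F (\<lambda>\<omega>. \<Sum>a\<in>S. h a \<omega> * I a \<omega>) \<omega>
      = (\<Sum>a\<in>S. real_cond_exp M F (\<lambda>\<omega>. h a \<omega> * I a \<omega>) \<omega>)"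
    by (intro F.real_cond_exp_sum int)
  have 3: "AE \<omega> in M. \<forall>a\<in>S. real_cond_exp M F (\<lambda>\<omega>. h a \<omega> * I a \<omega>) \<omega>
      = h a \<omega> * real_cond_exp M F (I a) \<omega>"
    using fin by (intro AE_finite_allI F.real_cond_exp_mult h I int)
  have 4: "AE \<omega> in M. \<forall>a\<in>S. real_cond_exp M F (I a) \<omega> = 1 / card S"
    using fin unif unfolding prob_given_def F_def[symmetric] I_def by (intro AE_finite_allI) auto
  show ?thesis
    using 1 2 3 4
  proof eventually_elim
    case (elim \<omega>)
    then have "prob_given M (count_space V) f Q \<omega> = (\<Sum>a\<in>S. h a \<omega> * (1 / card S))"
      by simp
    also have "\<dots> = (\<Sum>a\<in>S. h a \<omega>) / card S"
      by (simp add: sum_divide_distrib)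
    also have "(\<Sum>a\<in>S. h a \<omega>) = card {a\<in>S. R (f \<omega>) a}"
      using fin by (simp add: h_def Int_def)
    finally show ?case .
  qed
qed

section \<open>Permuted matrices and the orbit of \<open>A0\<close>\<close>

lemma finite_adj_matrices: "finite (adj_matrices n)"
  unfolding adj_matrices_def by (intro finite_PiE) auto

text \<open>This is a right action: the outer entry at \<open>(i, j)\<close> is the inner entry at
  \<open>(\<tau> i, \<tau> j)\<close>, and \<open>\<tau>\<close> keeps this pair inside the range to
  which \<open>perm_matrix\<close> is restricted.\<close>

lemma perm_matrix_comp:
  assumes "\<tau> permutes {1..n}"
  shows "perm_matrix n (perm_matrix n A \<sigma>) \<tau> = perm_matrix n A (\<sigma> \<circ> \<tau>)"
  using permutes_in_image[OF assms] by (auto simp: perm_matrix_def fun_eq_iff restrict_def)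

lemma perm_matrix_id:
  assumes "A \<in> adj_matrices n"
  shows "perm_matrix n A id = A"
  using assms unfolding perm_matrix_def adj_matrices_def
  by (auto simp: fun_eq_iff restrict_def PiE_def extensional_def)

context
  fixes G :: "(nat \<Rightarrow> nat) set" and n :: nat
  assumes G: "subgroup G (sym_group n)"
begin

lemma permutes_in_subgroup: "\<pi> \<in> G \<Longrightarrow> \<pi> permutes {1..n}"
  using subgroup.subset[OF G] by (auto simp: sym_group_carrier)

lemma finite_subgroup: "finite G"
  by (rule finite_subset[OF _ finite_permutations[of "{1..n}"]]) (use permutes_in_subgroup in auto)

lemma id_in_subgroup: "id \<in> G"
  using subgroup.one_closed[OF G] by (simp add: sym_group_one)

lemma comp_in_subgroup: "\<sigma> \<in> G \<Longrightarrow> \<tau> \<in> G \<Longrightarrow> \<sigma> \<circ> \<tau> \<in> G"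
  using subgroup.m_closed[OF G] by (simp add: sym_group_mult)

lemma inv_in_subgroup: "\<sigma> \<in> G \<Longrightarrow> inv_into UNIV \<sigma> \<in> G"
  using subgroup.m_inv_closed[OF G, of \<sigma>] subgroup.subset[OF G] by auto

lemma bij_betw_comp_left:
  assumes "\<sigma> \<in> G"
  shows "bij_betw ((\<circ>) \<sigma>) G G"
proof (rule bij_betw_byWitness[where f' = "(\<circ>) (inv_into UNIV \<sigma>)"])
  have p: "\<sigma> permutes {1..n}" using assms by (rule permutes_in_subgroup)
  show "\<forall>\<tau>\<in>G. inv_into UNIV \<sigma> \<circ> (\<sigma> \<circ> \<tau>) = \<tau>" "\<forall>\<tau>\<in>G. \<sigma> \<circ> (inv_into UNIV \<sigma> \<circ> \<tau>) = \<tau>"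
    using permutes_inv_o[OF p] by (simp_all add: o_assoc)
qed (use assms comp_in_subgroup inv_in_subgroup in auto)

text \<open>Acting by the inverse permutation undoes the action, and closure of \<open>G\<close>
  keeps it inside the orbit. Sums over the orbit can thus be reindexed, in the orbit count and for
  the weights of \<open>beta_hat\<close>.\<close>

lemma bij_betw_perm_matrix:
  assumes "\<pi> \<in> G"
  shows "bij_betw (\<lambda>A. perm_matrix n A \<pi>) (perm_matrix n A0 ` G) (perm_matrix n A0 ` G)"
proof (rule bij_betw_byWitness[where f' = "\<lambda>A. perm_matrix n A (inv_into UNIV \<pi>)"])
  note p = permutes_in_subgroup permutes_inv_o[OF permutes_in_subgroup] inv_in_subgroup
    comp_in_subgroup
  show "\<forall>A\<in>perm_matrix n A0 ` G. perm_matrix n (perm_matrix n A \<pi>) (inv_into UNIV \<pi>) = A"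
    "\<forall>A\<in>perm_matrix n A0 ` G. perm_matrix n (perm_matrix n A (inv_into UNIV \<pi>)) \<pi> = A"
    using assms p by (auto simp: perm_matrix_comp o_assoc[symmetric])
qed (use assms comp_in_subgroup inv_in_subgroup permutes_in_subgroup
      in \<open>auto simp: perm_matrix_comp\<close>)

text \<open>Counting the pairs \<open>(A, \<pi>)\<close> with \<open>P (A\<^sub>\<pi>)\<close> in both orders avoids the stabilizer of \<open>A0\<close>:
  by left translation in \<open>G\<close>, the number of good \<open>\<pi>\<close> does not depend on \<open>A\<close>.\<close>

lemma card_subgroup_perm_matrix:
  fixes A0 :: "nat \<times> nat \<Rightarrow> nat" and P
  defines "S \<equiv> perm_matrix n A0 ` G"
  assumes A: "A \<in> S"
  shows "real (card {\<pi>\<in>G. P (perm_matrix n A \<pi>)}) / card G = real (card {B\<in>S. P B}) / card S"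
proof -
  have fin: "finite S" and "S \<noteq> {}" unfolding S_def using finite_subgroup id_in_subgroup by auto
  then have pos: "card S > 0" "card G > 0"
    using finite_subgroup id_in_subgroup by (auto simp: card_gt_0_iff)
  let ?c = "\<lambda>B. \<Sum>\<pi>\<in>G. of_bool (P (perm_matrix n B \<pi>)) :: nat"
  have transl: "?c B = ?c A0" if B: "B \<in> S" for B
  proof -
    obtain \<sigma> where s: "\<sigma> \<in> G" and B: "B = perm_matrix n A0 \<sigma>" using B by (auto simp: S_def)
    have "?c B = (\<Sum>\<pi>\<in>G. of_bool (P (perm_matrix n A0 (\<sigma> \<circ> \<pi>))))"
      by (intro sum.cong) (simp_all add: B perm_matrix_comp[OF permutes_in_subgroup])
    also have "\<dots> = ?c A0"
      by (rule sum.reindex_bij_betw[OF bij_betw_comp_left[OF s]])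
    finally show ?thesis .
  qed
  have "card S * ?c A = (\<Sum>B\<in>S. ?c B)"
    using transl[OF A] transl by simp
  also have "\<dots> = (\<Sum>\<pi>\<in>G. \<Sum>B\<in>S. of_bool (P (perm_matrix n B \<pi>)))"
    by (rule sum.swap)
  \<comment> \<open>For fixed \<open>\<pi>\<close> the action permutes \<open>S\<close>, so the
    inner sum does not depend on \<open>\<pi>\<close>.\<close>
  also have "\<dots> = (\<Sum>\<pi>\<in>G. \<Sum>B\<in>S. of_bool (P B))"
    unfolding S_def
    by (intro sum.cong refl sum.reindex_bij_betw[OF bij_betw_perm_matrix, where g = "\<lambda>B. of_bool (P B)"])
  finally have "card S * card {\<pi>\<in>G. P (perm_matrix n A \<pi>)} = card G * card {B\<in>S. P B}"
    using fin finite_subgroup by (simp add: Int_def)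
  then show ?thesis
    using pos by (simp add: field_simps flip: of_nat_mult)
qed

text \<open>As \<open>\<pi>\<close> runs through \<open>G\<close>, every matrix of the orbit is hit
  equally often, so the average over \<open>G\<close> becomes a rank fraction over the
  orbit.\<close>

lemma p_value_perm_matrix:
  assumes "A \<in> perm_matrix n A0 ` G"
  shows "p_value G (T A) (\<lambda>\<pi>. T (perm_matrix n A \<pi>))
    = card {B \<in> perm_matrix n A0 ` G. T A \<le> T B} / card (perm_matrix n A0 ` G)"
  using card_subgroup_perm_matrix[OF assms, of "\<lambda>B. T A \<le> T B"] finite_subgroup
  by (simp add: p_value_def Int_def)

section \<open>Validity of the randomization test\<close>

text \<open>The common core of both claims. \<open>T\<close> takes the value of \<open>f\<close> as
  an argument, so conditioning on \<open>f\<close> fixes the statistic. The form of \<open>p\<close>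
  is prescribed only where \<open>X\<close> is in the orbit, since equivariance is available only
  there.\<close>

lemma randomization_p_value_valid:
  fixes T :: "'c \<Rightarrow> (nat \<times> nat \<Rightarrow> nat) \<Rightarrow> real" and A0 :: "nat \<times> nat \<Rightarrow> nat"
  defines "S \<equiv> perm_matrix n A0 ` G"
  assumes M: "prob_space M"
    and X: "X \<in> M \<rightarrow>\<^sub>M count_space U"
    and f: "f \<in> M \<rightarrow>\<^sub>M count_space V"
    and unif: "\<forall>A\<in>S.
      AE \<omega> in M. prob_given M (count_space V) f (\<lambda>\<omega>'. X \<omega>' = A) \<omega> = 1 / card S"
    and meas: "{\<omega> \<in> space M. p \<omega> \<le> \<alpha>} \<in> sets M"
    and p: "AE \<omega> in M. X \<omega> \<in> S \<longrightarrow>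
      p \<omega> = p_value G (T (f \<omega>) (X \<omega>)) (\<lambda>\<pi>. T (f \<omega>) (perm_matrix n (X \<omega>) \<pi>))"
    and "0 \<le> \<alpha>"
  shows "AE \<omega> in M. prob_given M (count_space V) f (\<lambda>\<omega>'. p \<omega>' \<le> \<alpha>) \<omega> \<le> \<alpha>"
proof -
  have fin: "finite S" and ne: "S \<noteq> {}"
    unfolding S_def using finite_subgroup id_in_subgroup by auto
  then have pos: "card S > 0" by (simp add: card_gt_0_iff)
  \<comment> \<open>The event \<open>p \<omega> \<le> \<alpha>\<close> for frozen values
    \<open>g\<close> of \<open>f\<close> and \<open>A\<close> of \<open>X\<close>, cleared of the
    division by \<open>card S\<close>.\<close>
  define R where "R g A \<longleftrightarrow> card {B\<in>S. T g A \<le> T g B} \<le> \<alpha> * card S" for g A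
  have "AE \<omega> in M. p \<omega> \<le> \<alpha> \<longleftrightarrow> R (f \<omega>) (X \<omega>)"
    using p AE_in_uniform_support(2)[OF M X f fin ne unif]
  proof eventually_elim
    case (elim \<omega>)
    then have "p \<omega> = card {B\<in>S. T (f \<omega>) (X \<omega>) \<le> T (f \<omega>) B} / card S"
      unfolding S_def by (simp add: p_value_perm_matrix)
    then show ?case using pos by (simp add: R_def divide_le_eq)
  qed
  from prob_given_uniform[where R = R, OF M X f fin ne unif meas this] show ?thesis
  proof eventually_elim
    case (elim \<omega>)
    have "card {A\<in>S. R (f \<omega>) A} \<le> \<alpha> * card S"
      unfolding R_def by (rule card_rank_fraction_le) (use fin \<open>0 \<le> \<alpha>\<close> in auto)
    then show ?case using elim pos by (simp add: divide_le_eq)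
  qed
qed

end

section \<open>The two regression statistics\<close>

text \<open>Stated with the pair already split, so that as a congruence rule it lets the simplifier
  assume \<open>(i, j) \<in> E\<close> inside the summand.\<close>

lemma sum_pairs_cong:
  assumes "\<And>i j. (i, j) \<in> E \<Longrightarrow> g i j = h i j"
  shows "(\<Sum>(i, j)\<in>E. g i j) = (\<Sum>(i, j)\<in>E. h i j)"
  using assms by (intro sum.cong) auto

text \<open>\<open>f\<close> is a random element, so that "given f" means conditioning on its
  sigma-algebra, and \<open>Yd\<close> receives the value of \<open>f\<close> because potential
  outcomes depend on nothing else random. The weights in the first claim are unconditional
  probabilities.\<close>

theorem proposition3:
  fixes M :: "'w measure"
    and n :: nat
    and A1 A2 :: "'w \<Rightarrow> (nat \<times> nat \<Rightarrow> nat)"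
    and f :: "'w \<Rightarrow> ((nat \<times> nat \<Rightarrow> nat) \<Rightarrow> (nat \<times> nat \<Rightarrow> nat))"
    and G :: "(nat \<Rightarrow> nat) set"
    and A0 :: "nat \<times> nat \<Rightarrow> nat"
    and \<A> :: "(nat \<times> nat \<Rightarrow> nat) set"
    and \<E> :: "(nat \<times> nat) set"
    and d y :: "nat \<Rightarrow> nat \<Rightarrow> (nat \<times> nat \<Rightarrow> nat) \<Rightarrow> real"
    and Yd :: "((nat \<times> nat \<Rightarrow> nat) \<Rightarrow> (nat \<times> nat \<Rightarrow> nat)) \<Rightarrow> nat \<Rightarrow> nat \<Rightarrow> real \<Rightarrow> real"
    and \<alpha> :: real
  assumes "prob_space M"
    and "A1 \<in> M \<rightarrow>\<^sub>M count_space (adj_matrices n)"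
    and "A2 \<in> M \<rightarrow>\<^sub>M count_space (adj_matrices n)"
    and "f \<in> M \<rightarrow>\<^sub>M count_space (adj_maps n)"
    and "subgroup G (sym_group n)"
    and "A0 \<in> adj_matrices n"
    and "\<A> = {perm_matrix n A0 \<pi> | \<pi>. \<pi> \<in> G}"
    and "\<E> \<subseteq> {1..n} \<times> {1..n}" and "\<E> \<noteq> {}"
    and asm1: "AE \<omega> in M. A2 \<omega> = f \<omega> (A1 \<omega>)"
    and asm3: "\<forall>A\<in>\<A>. AE \<omega> in M.
      prob_given M (count_space (adj_maps n)) f (\<lambda>\<omega>'. A1 \<omega>' = A) \<omega> = 1 / real (card \<A>)"
    and asm4: "AE \<omega> in M. \<forall>(i, j)\<in>\<E>. \<forall>\<delta>\<in>d i j ` \<A>. \<forall>A\<in>\<A>.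
      d i j A = \<delta> \<longrightarrow> y i j (f \<omega> A) = Yd (f \<omega>) i j \<delta>"
    and asm5a: "\<forall>\<pi>\<in>G. \<forall>(i, j)\<in>\<E>. (\<pi> i, \<pi> j) \<in> \<E>"
    and asm5b: "\<forall>\<pi>\<in>G. \<forall>(i, j)\<in>\<E>. \<forall>A\<in>\<A>. d i j (perm_matrix n A \<pi>) = d (\<pi> i) (\<pi> j) A"
    and sharp_null: "AE \<omega> in M. \<forall>(i, j)\<in>\<E>. \<forall>\<delta>\<in>d i j ` \<A>. \<forall>\<delta>'\<in>d i j ` \<A>.
      Yd (f \<omega>) i j \<delta> = Yd (f \<omega>) i j \<delta>'"
    and "0 < \<alpha>" and "\<alpha> < 1"
  shows
    "(\<forall>\<D> :: real set.
        finite \<D> \<and>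
        (\<forall>(i, j)\<in>\<E>. (AE \<omega> in M. d i j (A1 \<omega>) \<in> \<D>) \<and>
           (\<forall>\<delta>\<in>\<D>. \<P>(\<omega> in M. d i j (A1 \<omega>) = \<delta>) > 0)) \<and>
        (\<Sum>\<delta>\<in>\<D>. \<delta>\<^sup>2) > 0 \<longrightarrow>
        (AE \<omega> in M.
           prob_given M (count_space (adj_maps n)) f
             (\<lambda>\<omega>'. p_beta G \<E> (\<lambda>i j \<delta>. \<P>(\<omega>'' in M. d i j (A1 \<omega>'') = \<delta>))
                (\<lambda>i j. y i j (A2 \<omega>')) (\<lambda>i j. d i j (A1 \<omega>')) \<le> \<alpha>) \<omega> \<le> \<alpha>)) \<and>
     (\<forall>I J.
        I \<subseteq> {1..n} \<and> J \<subseteq> {1..n} \<and> I \<inter> J = {} \<and> \<E> = I \<times> J \<and>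
        G = {\<pi> \<in> carrier (sym_group n). \<forall>j. j \<notin> I \<longrightarrow> \<pi> j = j} \<and>
        (AE \<omega> in M. \<forall>j\<in>J. (\<Sum>i\<in>I. (d i j (A1 \<omega>))\<^sup>2) > 0) \<longrightarrow>
        (AE \<omega> in M.
           prob_given M (count_space (adj_maps n)) f
             (\<lambda>\<omega>'. p_gamma G I J
                (\<lambda>i j. y i j (A2 \<omega>')) (\<lambda>i j. d i j (A1 \<omega>')) \<le> \<alpha>) \<omega> \<le> \<alpha>))"
proof -
  interpret prob_space M by fact
  have S: "\<A> = perm_matrix n A0 ` G"
    using \<open>\<A> = _\<close> by auto
  \<comment> \<open>\<open>A0\<close> is in its own orbit through the identity and will serve as the
    reference matrix for the outcomes.\<close>
  have fin: "finite \<A>" and A0: "A0 \<in> \<A>"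
    using finite_subgroup id_in_subgroup perm_matrix_id[OF \<open>A0 \<in> _\<close>] \<open>subgroup G _\<close>
    unfolding S by (auto intro!: image_eqI[of A0 _ id])
  then have ne: "\<A> \<noteq> {}" by auto
  note A1 = \<open>A1 \<in> _\<close> and A2 = \<open>A2 \<in> _\<close> and f = \<open>f \<in> _\<close> and G = \<open>subgroup G _\<close>
  note support = AE_in_uniform_support[OF \<open>prob_space M\<close> A1 f fin ne asm3]
  have equivariant: "d (\<pi> i) (\<pi> j) A = d i j (perm_matrix n A \<pi>)"
    if "A \<in> \<A>" "\<pi> \<in> G" "(i, j) \<in> \<E>" for A \<pi> i j
    using bspec[OF bspec[OF asm5b that(2)] that(3)] that(1) by simp
  \<comment> \<open>The pair takes values in a finite discrete space, so any event in terms of it is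
    measurable, including those that involve \<open>arg_min\<close>.\<close>
  have meas: "{\<omega> \<in> space M. R (A1 \<omega>) (A2 \<omega>)} \<in> sets M" for R
  proof -
    have "(\<lambda>\<omega>. (A1 \<omega>, A2 \<omega>)) \<in> M \<rightarrow>\<^sub>M count_space (adj_matrices n \<times> adj_matrices n)"
      using measurable_Pair[OF A1 A2]
      by (simp add: pair_measure_countable finite_adj_matrices countable_finite)
    then have "Measurable.pred M (\<lambda>\<omega>. case (A1 \<omega>, A2 \<omega>) of (a, b) \<Rightarrow> R a b)"
      by (rule measurable_compose) simp
    then show ?thesis by (simp add: pred_def)
  qed
  \<comment> \<open>Each outcome is \<open>Yd\<close> at the attained exposure, and the sharp null
    lets that exposure be replaced by the one under \<open>A0\<close>.\<close>
  have Y: "AE \<omega> in M. A1 \<omega> \<in> \<A> \<longrightarrow> (\<forall>(i, j)\<in>\<E>. y i j (A2 \<omega>) = y i j (f \<omega> A0))"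
    using asm1 asm4 sharp_null
  proof eventually_elim
    case (elim \<omega>)
    have *: "y i j (f \<omega> A) = Yd (f \<omega>) i j (d i j A)" if "A \<in> \<A>" "(i, j) \<in> \<E>" for A i j
      using elim(2) that by blast
    have "y i j (f \<omega> A) = y i j (f \<omega> A0)" if "A \<in> \<A>" "(i, j) \<in> \<E>" for A i j
      unfolding *[OF that] *[OF A0 that(2)] using elim(3) that A0 by blast
    then show ?case unfolding elim(1) by blast
  qed
  \<comment> \<open>Both claims at once: \<open>t\<close> is the statistic and \<open>u\<close> its
    permuted version. It suffices that \<open>t\<close> reads \<open>Y\<close> only on
    \<open>\<E>\<close> and that permuting the exposures amounts to permuting the matrix.\<close>
  have level: "AE \<omega> in M. prob_given M (count_space (adj_maps n)) f
      (\<lambda>\<omega>'. p_value G (t (\<lambda>i j. y i j (A2 \<omega>')) (\<lambda>i j. d i j (A1 \<omega>')))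
        (u (\<lambda>i j. y i j (A2 \<omega>')) (\<lambda>i j. d i j (A1 \<omega>'))) \<le> \<alpha>) \<omega> \<le> \<alpha>"
    if cong: "\<And>Y Y' D. (\<And>i j. (i, j) \<in> \<E> \<Longrightarrow> Y i j = Y' i j) \<Longrightarrow> t Y D = t Y' D"
      and perm: "\<And>Y A \<pi>. A \<in> \<A> \<Longrightarrow> \<pi> \<in> G \<Longrightarrow>
        u Y (\<lambda>i j. d i j A) \<pi> = t Y (\<lambda>i j. d i j (perm_matrix n A \<pi>))"
    for t :: "(nat \<Rightarrow> nat \<Rightarrow> real) \<Rightarrow> (nat \<Rightarrow> nat \<Rightarrow> real) \<Rightarrow> real" and u
  \<comment> \<open>The outcomes are evaluated at \<open>A0\<close>, which turns the statistic into
    a function of \<open>f\<close> and the matrix.\<close>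
  proof (rule randomization_p_value_valid[where ?A0.0 = A0 and
        T = "\<lambda>g A. t (\<lambda>i j. y i j (g A0)) (\<lambda>i j. d i j A)", OF G \<open>prob_space M\<close> A1 f])
    show "AE \<omega> in M. A1 \<omega> \<in> perm_matrix n A0 ` G \<longrightarrow>
      p_value G (t (\<lambda>i j. y i j (A2 \<omega>)) (\<lambda>i j. d i j (A1 \<omega>)))
        (u (\<lambda>i j. y i j (A2 \<omega>)) (\<lambda>i j. d i j (A1 \<omega>))) =
      p_value G (t (\<lambda>i j. y i j (f \<omega> A0)) (\<lambda>i j. d i j (A1 \<omega>)))
        (\<lambda>\<pi>. t (\<lambda>i j. y i j (f \<omega> A0)) (\<lambda>i j. d i j (perm_matrix n (A1 \<omega>) \<pi>)))"
      using Y
    proof eventually_elim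
      case (elim \<omega>)
      show ?case
      proof
        assume A: "A1 \<omega> \<in> perm_matrix n A0 ` G"
        \<comment> \<open>\<open>D\<close> stays arbitrary to cover the observed and the permuted
          exposures alike.\<close>
        then have "t (\<lambda>i j. y i j (A2 \<omega>)) D = t (\<lambda>i j. y i j (f \<omega> A0)) D" for D
          using elim by (intro cong) (auto simp: S)
        with A show "p_value G (t (\<lambda>i j. y i j (A2 \<omega>)) (\<lambda>i j. d i j (A1 \<omega>)))
            (u (\<lambda>i j. y i j (A2 \<omega>)) (\<lambda>i j. d i j (A1 \<omega>))) =
          p_value G (t (\<lambda>i j. y i j (f \<omega> A0)) (\<lambda>i j. d i j (A1 \<omega>)))
            (\<lambda>\<pi>. t (\<lambda>i j. y i j (f \<omega> A0)) (\<lambda>i j. d i j (perm_matrix n (A1 \<omega>) \<pi>)))"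
          unfolding p_value_def by (simp add: perm S)
      qed
    qed
  qed (use meas[of "\<lambda>a b. p_value G (t (\<lambda>i j. y i j b) (\<lambda>i j. d i j a))
      (u (\<lambda>i j. y i j b) (\<lambda>i j. d i j a)) \<le> \<alpha>"] asm3 \<open>0 < \<alpha>\<close> in \<open>simp_all add: S\<close>)
  define p where "p i j \<delta> = \<P>(\<omega> in M. d i j (A1 \<omega>) = \<delta>)" for i j \<delta>
  \<comment> \<open>By uniformity \<open>p i j \<delta>\<close> is the fraction of the orbit with
    exposure \<open>\<delta>\<close>; equivariance moves \<open>\<pi>\<close> from the indices to
    the matrix, and the action only rearranges the orbit.\<close>
  have p: "p (\<pi> i) (\<pi> j) \<delta> = p i j \<delta>" if "\<pi> \<in> G" "(i, j) \<in> \<E>" for \<pi> i j \<delta>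
  proof -
    have card: "p i j \<delta> = (\<Sum>A\<in>\<A>. of_bool (d i j A = \<delta>) / card \<A>)" for i j
    proof -
      have m: "{\<omega> \<in> space M. A1 \<omega> = A} \<in> sets M" for A
        using meas[of "\<lambda>a b. a = A"] .
      \<comment> \<open>The two events agree only almost everywhere, as \<open>A1\<close> may leave
        the orbit on a null set.\<close>
      have "p i j \<delta> = prob (\<Union>A\<in>{A\<in>\<A>. d i j A = \<delta>}. {\<omega> \<in> space M. A1 \<omega> = A})"
        unfolding p_def
        using support(2) fin m meas[of "\<lambda>a b. d i j a = \<delta>"]
        by (intro finite_measure_eq_AE) (auto intro!: sets.finite_UN)
      also have "\<dots> = (\<Sum>A\<in>{A\<in>\<A>. d i j A = \<delta>}. \<P>(\<omega> in M. A1 \<omega> = A))"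
        using fin m by (intro finite_measure_finite_Union) (auto simp: disjoint_family_on_def)
      also have "\<dots> = (\<Sum>A\<in>\<A>. of_bool (d i j A = \<delta>) / card \<A>)"
        using fin support(1) by (simp add: sum.inter_filter Int_def flip: sum_divide_distrib)
      finally show ?thesis .
    qed
    have "p (\<pi> i) (\<pi> j) \<delta> = (\<Sum>A\<in>\<A>. of_bool (d i j (perm_matrix n A \<pi>) = \<delta>) / card \<A>)"
      unfolding card using equivariant that by (intro sum.cong) simp_all
    also have "\<dots> = p i j \<delta>"
      unfolding card using bij_betw_perm_matrix[OF G \<open>\<pi> \<in> G\<close>, of A0]
      by (intro sum.reindex_bij_betw[where g = "\<lambda>A. of_bool (d i j A = \<delta>) / card \<A>"]) (simp add: S)
    finally show ?thesis .
  qed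
  show ?thesis
  proof (intro conjI allI impI)
    show "AE \<omega> in M. prob_given M (count_space (adj_maps n)) f
       (\<lambda>\<omega>'. p_beta G \<E> (\<lambda>i j \<delta>. \<P>(\<omega>'' in M. d i j (A1 \<omega>'') = \<delta>))
          (\<lambda>i j. y i j (A2 \<omega>')) (\<lambda>i j. d i j (A1 \<omega>')) \<le> \<alpha>) \<omega> \<le> \<alpha>"
      unfolding p_beta_def p_def[symmetric]
    proof (rule level)
      show "beta_hat \<E> p Y D = beta_hat \<E> p Y' D"
        if "\<And>i j. (i, j) \<in> \<E> \<Longrightarrow> Y i j = Y' i j" for Y Y' D
        unfolding beta_hat_def using that by (simp cong: sum_pairs_cong)
      \<comment> \<open>With invariant weights the two objectives are the same function of
        \<open>b\<close>, hence \<open>arg_min\<close> selects the same value.\<close>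
      show "beta_hat_perm \<E> p Y (\<lambda>i j. d i j A) \<pi> = beta_hat \<E> p Y (\<lambda>i j. d i j (perm_matrix n A \<pi>))"
        if "A \<in> \<A>" "\<pi> \<in> G" for Y A \<pi>
        unfolding beta_hat_def beta_hat_perm_def using p[OF \<open>\<pi> \<in> G\<close>] equivariant[OF that]
        by (simp cong: sum_pairs_cong)
    qed
  next
    fix I J
    assume IJ: "I \<subseteq> {1..n} \<and> J \<subseteq> {1..n} \<and> I \<inter> J = {} \<and> \<E> = I \<times> J \<and>
      G = {\<pi> \<in> carrier (sym_group n). \<forall>j. j \<notin> I \<longrightarrow> \<pi> j = j} \<and>
      (AE \<omega> in M. \<forall>j\<in>J. (\<Sum>i\<in>I. (d i j (A1 \<omega>))\<^sup>2) > 0)"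
    show "AE \<omega> in M. prob_given M (count_space (adj_maps n)) f
       (\<lambda>\<omega>'. p_gamma G I J (\<lambda>i j. y i j (A2 \<omega>')) (\<lambda>i j. d i j (A1 \<omega>')) \<le> \<alpha>) \<omega> \<le> \<alpha>"
      unfolding p_gamma_def
    proof (rule level)
      show "gamma_hat I J Y D = gamma_hat I J Y' D"
        if "\<And>i j. (i, j) \<in> \<E> \<Longrightarrow> Y i j = Y' i j" for Y Y' D
        unfolding gamma_hat_def using that IJ by simp
      show "gamma_hat_perm I J Y (\<lambda>i j. d i j A) \<pi> = gamma_hat I J Y (\<lambda>i j. d i j (perm_matrix n A \<pi>))"
        if "A \<in> \<A>" "\<pi> \<in> G" for Y A \<pi>
      proof -
        \<comment> \<open>Only the first index is permuted in \<open>gamma_hat_perm\<close>; this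
          fits equivariance because \<open>\<pi>\<close> fixes \<open>J\<close>, which is disjoint
          from \<open>I\<close>.\<close>
        have "d (\<pi> i) j A = d i j (perm_matrix n A \<pi>)"
          if ij: "i \<in> I" "j \<in> J" for i j
        proof -
          have "\<pi> j = j" using IJ \<open>\<pi> \<in> G\<close> ij by auto
          then show ?thesis using equivariant[OF \<open>A \<in> \<A>\<close> \<open>\<pi> \<in> G\<close>, of i j] IJ ij by simp
        qed
        then show ?thesis
          unfolding gamma_hat_def gamma_hat_perm_def by simp
      qed
    qed
  qed
qed

end
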